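(* Let $K$ be the Epanechnikov kernel, let $C_{(1)}<\dots<C_{(M)}$ be the atoms of a step CDF with jump masses $\Delta_i\ge0$, let $\varepsilon>0$, let $d_j(h)$ be the deviation at atom $C_{(j)}$ of the kernel-smoothed CDF with bandwidth $h>0$ from the midpoint target (defined in the context), let $\mathcal{F}=\{h>0:\max_{1\le j\le M}|d_j(h)|\le\varepsilon\}$ and let $h^\star=\max\mathcal{F}$ be the largest feasible bandwidth. Suppose that $\mathcal{F}$ is connected, equivalently a single interval of the form $\mathcal{F}=(0,h^\star]$; in particular, it is required that the first bandwidth at which $\max_{1\le j\le M}|d_j(h)|$ hits $\varepsilon$ from the left is also the right-most end of the feasible region. Then the feasible region connected to $h\to0^+$ ends at the first bandwidth at which any atom's deviation reaches $\varepsilon$; hence $$h^\star=\min_{1\le j\le M}\ \inf\{h>0:\ |d_j(h)|=\varepsilon\},$$ i.e. the global minimum over all valid crossings obtained by solving, for each atom $j$ and each interval of $h$ on which the active set $S_j(h)$ is constant, the cubics $$c_0-\tfrac34c_1u+\tfrac14c_3u^3=\pm\varepsilon,\qquad u=1/h,$$ where a root is valid if $h=1/u>0$ lies in the interval in question. Each per-atom, per-interval crossing is a closed-form Cardano root, and $h^\star$ is the minimum of the finitely many valid ones.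
   Context: The Epanechnikov kernel is $K(t)=\tfrac34(1-t^2)\mathbf{1}\{|t|\le1\}$; its CDF is $\mathbb{K}(t)=0$ for $t<-1$, $\mathbb{K}(t)=\tfrac12+\tfrac34t-\tfrac14t^3$ for $-1\le t\le1$, $\mathbb{K}(t)=1$ for $t>1$. The step CDF is $Q_n(y)=\sum_{i=1}^M\Delta_iH(y-C_{(i)})$ with $H$ the Heaviside step function; put $F_0=0$, $F_i=\sum_{k\le i}\Delta_k$. The smoothed CDF with bandwidth $h>0$ is $Q_n^h(y)=\sum_{i=1}^M\Delta_i\,\mathbb{K}\bigl((y-C_{(i)})/h\bigr)$. The midpoint target at $C_{(j)}$ is $t_j=F_{j-1}+\tfrac12\Delta_j$, and $d_j(h)=Q_n^h(C_{(j)})-t_j$. The active set is $S_j(h)=\{i\ne j:|C_{(i)}-C_{(j)}|<h\}$; it changes only at the breakpoints $h=|C_{(i)}-C_{(j)}|$. With $s_i=\operatorname{sgn}(C_{(i)}-C_{(j)})$ and $S=S_j(h)$, the coefficients (which depend on $j$ and are constant on each interval of $h$ where $S_j(h)$ is fixed) are $$c_0=\tfrac12\sum_{i\in S}s_i\Delta_i,\quad c_1=\sum_{i\in S}\Delta_i(C_{(i)}-C_{(j)}),\quad c_3=\sum_{i\in S}\Delta_i(C_{(i)}-C_{(j)})^3,$$ and $d_j(h)=c_0-\tfrac34c_1u+\tfrac14c_3u^3$ with $u=1/h$. Convention: $\inf\emptyset=+\infty$.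
   Formalization: If c1 = c3 = 0 and c0 = ±ε, every h in the interval is a valid root, so finiteness is claimed only for equations with (c1,c3) ≠ (0,0); h* is still least among all crossings. The Cardano form is given for c3 ≠ 0, a linear closed form for c3 = 0, c1 ≠ 0. *)

theory Defs
  imports "HOL-Analysis.Analysis"
begin

text \<open>
  Throughout, the atoms are \<open>C 1 < \<dots> < C M\<close> and their masses are \<open>\<Delta> 1, \<dots>, \<Delta> M\<close>;
  values outside \<open>{1..M}\<close> are irrelevant.
\<close>

definition epan_kernel :: "real \<Rightarrow> real" where
  "epan_kernel t = (if \<bar>t\<bar> \<le> 1 then 3/4 * (1 - t^2) else 0)"

definition epan_cdf :: "real \<Rightarrow> real" where
  "epan_cdf t = (if t < -1 then 0 else if t \<le> 1 then 1/2 + 3/4 * t - 1/4 * t^3 else 1)"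

lemma epan_cdf_integral: "(epan_kernel has_integral epan_cdf t) {..t}"
proof -
  define b where "b = max (-1) (min t 1)"
  define G :: "real \<Rightarrow> real" where "G = (\<lambda>x. 3/4 * x - 1/4 * x^3)"
  have "-1 \<le> b" by (simp add: b_def)
  have "((\<lambda>x. 3/4 * (1 - x^2)) has_integral (G b - G (-1))) {-1..b}"
  proof (rule fundamental_theorem_of_calculus[OF \<open>-1 \<le> b\<close>])
    fix x :: real assume "x \<in> {-1..b}"
    have "(G has_real_derivative 3/4 * (1 - x^2)) (at x within {-1..b})"
      unfolding G_def by (auto intro!: derivative_eq_intros simp: algebra_simps)
    thus "(G has_vector_derivative 3/4 * (1 - x^2)) (at x within {-1..b})"
      by (simp add: has_real_derivative_iff_has_vector_derivative)
  qed
  moreover have "G b - G (-1) = epan_cdf t"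
    by (auto simp: G_def b_def epan_cdf_def max_def min_def)
  ultimately have "((\<lambda>x. 3/4 * (1 - x^2)) has_integral epan_cdf t) {-1..b}"
    by simp
  hence "((\<lambda>x. if x \<in> {-1..b} then 3/4 * (1 - x^2) else 0) has_integral epan_cdf t) UNIV"
    by (simp only: has_integral_restrict_UNIV)
  moreover have "(if x \<in> {-1..b} then 3/4 * (1 - x^2) else 0)
                  = (if x \<in> {..t} then epan_kernel x else 0)" for x :: real
    by (auto simp: b_def epan_kernel_def abs_le_iff max_def min_def split: if_splits)
  ultimately have "((\<lambda>x. if x \<in> {..t} then epan_kernel x else 0) has_integral epan_cdf t) UNIV"
    by simp
  thus ?thesis by (simp only: has_integral_restrict_UNIV)
qed

definition smoothed_cdf ::
  "(nat \<Rightarrow> real) \<Rightarrow> (nat \<Rightarrow> real) \<Rightarrow> nat \<Rightarrow> real \<Rightarrow> real \<Rightarrow> real" where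
  "smoothed_cdf C \<Delta> M h y = (\<Sum>i=1..M. \<Delta> i * epan_cdf ((y - C i) / h))"

definition cum_mass :: "(nat \<Rightarrow> real) \<Rightarrow> nat \<Rightarrow> real" where
  "cum_mass \<Delta> i = (\<Sum>k=1..i. \<Delta> k)"

definition midpoint_target :: "(nat \<Rightarrow> real) \<Rightarrow> nat \<Rightarrow> real" where
  "midpoint_target \<Delta> j = cum_mass \<Delta> (j - 1) + 1/2 * \<Delta> j"

definition dev ::
  "(nat \<Rightarrow> real) \<Rightarrow> (nat \<Rightarrow> real) \<Rightarrow> nat \<Rightarrow> nat \<Rightarrow> real \<Rightarrow> real" where
  "dev C \<Delta> M j h = smoothed_cdf C \<Delta> M h (C j) - midpoint_target \<Delta> j"

definition max_dev ::
  "(nat \<Rightarrow> real) \<Rightarrow> (nat \<Rightarrow> real) \<Rightarrow> nat \<Rightarrow> real \<Rightarrow> real" where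
  "max_dev C \<Delta> M h = (MAX j\<in>{1..M}. \<bar>dev C \<Delta> M j h\<bar>)"

definition feasible ::
  "(nat \<Rightarrow> real) \<Rightarrow> (nat \<Rightarrow> real) \<Rightarrow> nat \<Rightarrow> real \<Rightarrow> real set" where
  "feasible C \<Delta> M \<epsilon> = {h. 0 < h \<and> max_dev C \<Delta> M h \<le> \<epsilon>}"

text \<open>The part of the feasible region connected to \<open>h \<rightarrow> 0+\<close>.\<close>

definition initial_feasible ::
  "(nat \<Rightarrow> real) \<Rightarrow> (nat \<Rightarrow> real) \<Rightarrow> nat \<Rightarrow> real \<Rightarrow> real set" where
  "initial_feasible C \<Delta> M \<epsilon> = {h. 0 < h \<and> {0<..h} \<subseteq> feasible C \<Delta> M \<epsilon>}"

text \<open>\<open>h\<close> is the first bandwidth at which the maximal deviation hits \<open>\<epsilon>\<close>, coming from the left.\<close>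

definition first_hit ::
  "(nat \<Rightarrow> real) \<Rightarrow> (nat \<Rightarrow> real) \<Rightarrow> nat \<Rightarrow> real \<Rightarrow> real \<Rightarrow> bool" where
  "first_hit C \<Delta> M \<epsilon> h \<longleftrightarrow>
     0 < h \<and> max_dev C \<Delta> M h = \<epsilon> \<and> (\<forall>g. 0 < g \<and> g < h \<longrightarrow> max_dev C \<Delta> M g < \<epsilon>)"

definition active_set :: "(nat \<Rightarrow> real) \<Rightarrow> nat \<Rightarrow> nat \<Rightarrow> real \<Rightarrow> nat set" where
  "active_set C M j h = {i \<in> {1..M}. i \<noteq> j \<and> \<bar>C i - C j\<bar> < h}"

text \<open>
  Active sets grow with the bandwidth, so the intervals of constancy of \<open>active_set C M j\<close>
  on \<open>{0<..}\<close> are its level sets. They are indexed by the values \<open>S\<close> that are attained.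
\<close>

definition active_sets :: "(nat \<Rightarrow> real) \<Rightarrow> nat \<Rightarrow> nat \<Rightarrow> nat set set" where
  "active_sets C M j = active_set C M j ` {0<..}"

definition active_interval :: "(nat \<Rightarrow> real) \<Rightarrow> nat \<Rightarrow> nat \<Rightarrow> nat set \<Rightarrow> real set" where
  "active_interval C M j S = {h. 0 < h \<and> active_set C M j h = S}"

lemma is_interval_active_interval: "is_interval (active_interval C M j S)"
  unfolding is_interval_1
proof (intro ballI allI impI)
  fix a b x
  assume ab: "a \<in> active_interval C M j S" "b \<in> active_interval C M j S" and x: "a \<le> x \<and> x \<le> b"
  have "active_set C M j a \<subseteq> active_set C M j x" "active_set C M j x \<subseteq> active_set C M j b"
    using x by (auto simp: active_set_def)
  with ab x show "x \<in> active_interval C M j S"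
    by (auto simp: active_interval_def)
qed

definition coeff0 :: "(nat \<Rightarrow> real) \<Rightarrow> (nat \<Rightarrow> real) \<Rightarrow> nat \<Rightarrow> nat set \<Rightarrow> real" where
  "coeff0 C \<Delta> j S = 1/2 * (\<Sum>i\<in>S. sgn (C i - C j) * \<Delta> i)"

definition coeff1 :: "(nat \<Rightarrow> real) \<Rightarrow> (nat \<Rightarrow> real) \<Rightarrow> nat \<Rightarrow> nat set \<Rightarrow> real" where
  "coeff1 C \<Delta> j S = (\<Sum>i\<in>S. \<Delta> i * (C i - C j))"

definition coeff3 :: "(nat \<Rightarrow> real) \<Rightarrow> (nat \<Rightarrow> real) \<Rightarrow> nat \<Rightarrow> nat set \<Rightarrow> real" where
  "coeff3 C \<Delta> j S = (\<Sum>i\<in>S. \<Delta> i * (C i - C j) ^ 3)"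

text \<open>
  The valid roots, as bandwidths, of the cubic of atom \<open>j\<close> on the interval belonging to \<open>S\<close>,
  with right-hand side \<open>e\<close> (either \<open>\<epsilon>\<close> or \<open>-\<epsilon>\<close>).
\<close>

definition crossings ::
  "(nat \<Rightarrow> real) \<Rightarrow> (nat \<Rightarrow> real) \<Rightarrow> nat \<Rightarrow> nat \<Rightarrow> nat set \<Rightarrow> real \<Rightarrow> real set" where
  "crossings C \<Delta> M j S e =
     {h \<in> active_interval C M j S.
        \<exists>u. u = 1 / h \<and>
            coeff0 C \<Delta> j S - 3/4 * coeff1 C \<Delta> j S * u + 1/4 * coeff3 C \<Delta> j S * u ^ 3 = e}"

definition atom_crossings ::
  "(nat \<Rightarrow> real) \<Rightarrow> (nat \<Rightarrow> real) \<Rightarrow> nat \<Rightarrow> real \<Rightarrow> nat \<Rightarrow> real set" where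
  "atom_crossings C \<Delta> M \<epsilon> j = (\<Union>S\<in>active_sets C M j. \<Union>e\<in>{\<epsilon>, -\<epsilon>}. crossings C \<Delta> M j S e)"

text \<open>
  If \<open>coeff1\<close> and \<open>coeff3\<close> both vanish, the equation does not involve \<open>u\<close>: it has either no
  valid root or a whole interval of them. The following are the crossings of the remaining,
  genuine equations.
\<close>

definition proper_atom_crossings ::
  "(nat \<Rightarrow> real) \<Rightarrow> (nat \<Rightarrow> real) \<Rightarrow> nat \<Rightarrow> real \<Rightarrow> nat \<Rightarrow> real set" where
  "proper_atom_crossings C \<Delta> M \<epsilon> j =
     (\<Union>S\<in>{S \<in> active_sets C M j. \<not> (coeff1 C \<Delta> j S = 0 \<and> coeff3 C \<Delta> j S = 0)}.
        \<Union>e\<in>{\<epsilon>, -\<epsilon>}. crossings C \<Delta> M j S e)"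

text \<open>
  Cardano's formula for \<open>t^3 + p t + q = 0\<close>, with \<open>k = 0, 1, 2\<close> selecting the cube root. The
  radicals are complex (three real roots lead to non-real radicands). The case distinction picks
  a nonzero radicand whenever there is one; both vanish only for \<open>p = q = 0\<close>, where the value
  is the triple root \<open>0\<close> because \<open>0 powr (1/3) = 0\<close> and division by \<open>0\<close> gives \<open>0\<close>.
\<close>

definition cardano_root :: "real \<Rightarrow> real \<Rightarrow> nat \<Rightarrow> complex" where
  "cardano_root p q k =
     (let s = csqrt (of_real (q^2 / 4 + p^3 / 27));
          a = - of_real (q / 2) + s;
          w = (if a \<noteq> 0 then a else - of_real (q / 2) - s);
          v = cis (2 * pi * real k / 3) * w powr (1/3)
      in v - of_real p / (3 * v))"

end

theory Submission
  imports Defs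
begin

text \<open>
  Every deviation is a continuous function of the bandwidth that vanishes below the smallest gap
  between atoms, so the first bandwidth at which some deviation reaches \<open>\<epsilon>\<close> exists; by hypothesis it
  is \<open>hstar\<close>. On a level set of the active set the deviation is a cubic in \<open>1/h\<close>. These level sets
  are left-open intervals: if the cubic active at \<open>hstar\<close> were constant, the level \<open>\<epsilon>\<close> would be
  attained strictly to the left of \<open>hstar\<close> as well. Hence \<open>hstar\<close> is a root of a genuine cubic or
  linear equation.
\<close>

section \<open>Cardano's formula\<close>

lemma cis_third_power:
  "cis (2 * pi * real k / 3) = cis (2 * pi / 3) ^ k"
  by (simp add: Complex.DeMoivre mult_ac)

lemma cis_third_root:
  fixes \<omega> :: complex
  defines "\<omega> \<equiv> cis (2 * pi / 3)"
  shows "\<omega> ^ 3 = 1" "1 + \<omega> + \<omega>\<^sup>2 = 0"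
proof -
  show 1: "\<omega> ^ 3 = 1"
    unfolding \<omega>_def by (simp add: Complex.DeMoivre)
  have "\<omega> \<noteq> 1"
    unfolding \<omega>_def by (simp add: complex_eq_iff cos_120)
  moreover have "(\<omega> - 1) * (1 + \<omega> + \<omega>\<^sup>2) = \<omega> ^ 3 - 1"
    by (simp add: algebra_simps power2_eq_square power3_eq_cube)
  ultimately show "1 + \<omega> + \<omega>\<^sup>2 = 0"
    using 1 by simp
qed

text \<open>The factorization of \<open>x\<^sup>3 + y\<^sup>3 + z\<^sup>3 - 3 x y z\<close> at \<open>x = t\<close>, \<open>y = - v\<close>, \<open>z = - m\<close>.\<close>

lemma cubic_factorization:
  fixes t v m \<omega> :: complex
  assumes "1 + \<omega> + \<omega>\<^sup>2 = 0"
  shows "(t - (v + m)) * (t - (\<omega> * v + \<omega>\<^sup>2 * m)) * (t - (\<omega>\<^sup>2 * v + \<omega> * m)) =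
    t ^ 3 - 3 * v * m * t - (v ^ 3 + m ^ 3)"
proof -
  have "\<omega>\<^sup>2 = - 1 - \<omega>"
    using assms by (simp add: algebra_simps add_eq_0_iff)
  moreover from this have "\<omega> * \<omega> = - 1 - \<omega>"
    by (simp add: power2_eq_square)
  ultimately show ?thesis
    by algebra
qed

text \<open>With \<open>v\<close> a cube root of the radicand \<open>w\<close> and
  \<open>m = - p / (3 v)\<close>, one has \<open>3 v m = - p\<close> and
  \<open>v ^ 3 + m ^ 3 = - q\<close>, so \<open>cubic_factorization\<close> splits the cubic into
  linear factors whose zeros are the three values of \<open>cardano_root\<close>.\<close>

lemma cardano_root_iff:
  fixes p q :: real and t :: complex
  shows "t ^ 3 + of_real p * t + of_real q = 0 \<longleftrightarrow> (\<exists>k<3. t = cardano_root p q k)"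
proof -
  define s where "s = csqrt (of_real (q^2 / 4 + p^3 / 27))"
  define a where "a = - of_real (q / 2) + s"
  define w where "w = (if a \<noteq> 0 then a else - of_real (q / 2) - s)"
  define v where "v = w powr (1/3)"
  define \<omega> where "\<omega> = cis (2 * pi / 3)"
  have root: "cardano_root p q k = \<omega> ^ k * v - of_real p / (3 * (\<omega> ^ k * v))" for k
    unfolding cardano_root_def Let_def v_def w_def a_def s_def \<omega>_def cis_third_power ..
  have all_k: "(\<exists>k<3. t = cardano_root p q k) \<longleftrightarrow>
      t = cardano_root p q 0 \<or> t = cardano_root p q 1 \<or> t = cardano_root p q 2"
    by (auto simp: numeral_3_eq_3 numeral_2_eq_2 less_Suc_eq)
  have \<omega>: "\<omega> ^ 3 = 1" "1 + \<omega> + \<omega>\<^sup>2 = 0"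
    unfolding \<omega>_def by (rule cis_third_root)+
  have \<omega>0: "\<omega> \<noteq> 0"
    by (simp add: \<omega>_def)
  have s2: "s\<^sup>2 = (of_real q)\<^sup>2 / 4 + (of_real p) ^ 3 / 27"
    by (simp add: s_def)
  show ?thesis
  proof (cases "w = 0")
    case True
    \<comment> \<open>By the choice of \<open>w\<close>, it vanishes only if both radicands do; this
      forces \<open>p = q = 0\<close>.\<close>
    hence as: "a = 0" "- of_real (q / 2) - s = 0"
      unfolding w_def by (auto split: if_splits)
    hence "s = of_real (q / 2)" "- of_real (q / 2) = s"
      unfolding a_def by (simp_all add: algebra_simps)
    hence "q = 0" "s = 0"
      by (simp_all add: complex_eq_iff)
    with s2 have "p = 0"
      by simp
    have "cardano_root p q k = 0" for k
      using True by (simp add: root v_def)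
    hence "(\<exists>k<3. t = cardano_root p q k) \<longleftrightarrow> t = 0"
      unfolding all_k by simp
    with \<open>p = 0\<close> \<open>q = 0\<close> show ?thesis
      by simp
  next
    case False
    hence v0: "v \<noteq> 0"
      by (simp add: v_def)
    have v3: "v ^ 3 = w"
      using False by (simp add: v_def powr_power)
    \<comment> \<open>Whichever sign of \<open>s\<close> was taken, \<open>w\<close> solves the
      resolvent quadratic \<open>w ^ 2 + q w - p ^ 3 / 27 = 0\<close>.\<close>
    have "(w + of_real (q / 2))\<^sup>2 = s\<^sup>2"
      unfolding w_def a_def by (auto simp: power2_eq_square algebra_simps)
    hence w2: "w\<^sup>2 + of_real q * w = of_real p ^ 3 / 27"
      unfolding s2 by (simp add: power2_sum power_divide mult.commute)
    define m where "m = - of_real p / (3 * v)"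
    \<comment> \<open>The roots of the resolvent have product \<open>- p ^ 3 / 27\<close>, so
      \<open>m ^ 3\<close> is its other root.\<close>
    have m3: "m ^ 3 = - (of_real p ^ 3 / 27) / w"
      unfolding m_def v3[symmetric] by (simp add: power_divide power_mult_distrib)
    have q: "v ^ 3 + m ^ 3 = - of_real q"
      unfolding m3 v3 w2[symmetric] using False by (simp add: field_simps power2_eq_square)
    have p: "- 3 * v * m = of_real p"
      using v0 by (simp add: m_def)
    \<comment> \<open>Multiplying \<open>v\<close> by a power of \<open>\<omega>\<close> divides
      \<open>m\<close> by it, and dividing by one of \<open>\<omega>\<close>,
      \<open>\<omega> ^ 2\<close> is multiplying by the other.\<close>
    have inv1: "1 / \<omega> = \<omega>\<^sup>2" and inv2: "1 / \<omega>\<^sup>2 = \<omega>"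
      using \<omega>(1) \<omega>0 by (simp_all add: field_simps power2_eq_square power3_eq_cube)
    have quot: "- of_real p / (3 * (c * v)) = (1 / c) * m" for c :: complex
      by (simp add: m_def)
    have r: "cardano_root p q 0 = v + m"
      "cardano_root p q 1 = \<omega> * v + \<omega>\<^sup>2 * m"
      "cardano_root p q 2 = \<omega>\<^sup>2 * v + \<omega> * m"
      unfolding root
      using quot[of 1] quot[of \<omega>] quot[of "\<omega>\<^sup>2"] by (simp_all add: inv1 inv2)
    have "t ^ 3 + of_real p * t + of_real q = t ^ 3 - 3 * v * m * t - (v ^ 3 + m ^ 3)"
      unfolding q p[symmetric] by simp
    also have "\<dots> = (t - (v + m)) * (t - (\<omega> * v + \<omega>\<^sup>2 * m)) * (t - (\<omega>\<^sup>2 * v + \<omega> * m))"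
      by (rule cubic_factorization[OF \<omega>(2), symmetric])
    finally show ?thesis
      unfolding all_k r by simp
  qed
qed

text \<open>A real root may be given by non-real radicals, so the formula is compared with
  \<open>u\<close> inside the complex numbers.\<close>

corollary cardano_root_real_iff:
  fixes p q u :: real
  shows "u ^ 3 + p * u + q = 0 \<longleftrightarrow> (\<exists>k<3. complex_of_real u = cardano_root p q k)"
  unfolding cardano_root_iff[symmetric]
  by (simp flip: of_real_power of_real_mult of_real_add)

section \<open>The deviation as a function of the bandwidth\<close>

lemma continuous_epan_cdf: "continuous_on UNIV epan_cdf"
proof -
  \<comment> \<open>Clamping to [-1, 1] merges the three branches, since the middle cubic takes the
    values 0 and 1 at the ends.\<close>
  define b :: "real \<Rightarrow> real" where "b = (\<lambda>t. max (-1) (min t 1))"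
  have "epan_cdf = (\<lambda>t. 1/2 + 3/4 * b t - 1/4 * b t ^ 3)"
    by (auto simp: fun_eq_iff epan_cdf_def b_def max_def min_def)
  moreover have "continuous_on UNIV (\<lambda>t. 1/2 + 3/4 * b t - 1/4 * b t ^ 3)"
    unfolding b_def by (intro continuous_intros)
  ultimately show ?thesis
    by (simp only:)
qed

lemma continuous_on_dev: "continuous_on {0<..} (dev C \<Delta> M j)"
proof -
  have "continuous_on {0<..} (\<lambda>h. epan_cdf ((C j - C i) / h))" for i
    by (rule continuous_on_compose2[OF continuous_epan_cdf]) (auto intro!: continuous_intros)
  thus ?thesis
    unfolding dev_def smoothed_cdf_def by (intro continuous_intros)
qed

text \<open>Distributes the target over the atoms, with the weights of a Heaviside function that is
  1/2 at its jump, so that it can be subtracted from the smoothed CDF term by term.\<close>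

lemma midpoint_target_eq:
  assumes "j \<in> {1..M}"
  shows "midpoint_target \<Delta> j =
    (\<Sum>i=1..M. \<Delta> i * (if i < j then 1 else if i = j then 1/2 else 0))"
proof -
  have "(\<Sum>i=1..M. \<Delta> i * (if i < j then 1 else if i = j then 1/2 else 0)) =
      (\<Sum>i=1..M. (if i \<in> {1..j - 1} then \<Delta> i else 0) + (if i = j then 1/2 * \<Delta> i else 0))"
    using assms by (intro sum.cong) auto
  also have "\<dots> = (\<Sum>i\<in>{1..M} \<inter> {1..j - 1}. \<Delta> i) + 1/2 * \<Delta> j"
    using assms by (subst sum.inter_restrict) (simp_all add: sum.distrib)
  also have "{1..M} \<inter> {1..j - 1} = {1..j - 1}"
    using assms by auto
  finally show ?thesis
    by (simp add: midpoint_target_def cum_mass_def)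
qed

text \<open>After termwise subtraction an atom outside \<open>S\<close> contributes nothing: it is
  \<open>j\<close> itself, where the CDF is 1/2, or its distance from \<open>C j\<close> is at least
  \<open>h\<close>, where the CDF has saturated. On \<open>S\<close> the middle branch of
  \<open>epan_cdf\<close> applies.\<close>

lemma dev_eq_cubic:
  assumes mono: "strict_mono_on {1..M} C" and j: "j \<in> {1..M}" and h: "0 < h"
  defines "S \<equiv> active_set C M j h"
  shows "dev C \<Delta> M j h =
    coeff0 C \<Delta> j S - 3/4 * coeff1 C \<Delta> j S * (1 / h) + 1/4 * coeff3 C \<Delta> j S * (1 / h) ^ 3"
proof -
  define \<tau> where "\<tau> = (\<lambda>i. if i < j then 1 else if i = j then 1/2 else (0::real))"
  define f where "f = (\<lambda>i. \<Delta> i * (epan_cdf ((C j - C i) / h) - \<tau> i))"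
  define g where "g = (\<lambda>i. 1/2 * (sgn (C i - C j) * \<Delta> i)
      - 3/4 * (\<Delta> i * (C i - C j)) * (1 / h) + 1/4 * (\<Delta> i * (C i - C j) ^ 3) * (1 / h) ^ 3)"
  have order: "i < j \<longleftrightarrow> C i < C j" "i = j \<longleftrightarrow> C i = C j" if "i \<in> {1..M}" for i
    using strict_mono_on_less[OF mono that j] strict_mono_on_eq[OF mono that j] by auto
  have "dev C \<Delta> M j h = (\<Sum>i=1..M. f i)"
    unfolding dev_def smoothed_cdf_def midpoint_target_eq[OF j] f_def \<tau>_def
    by (simp add: sum_subtractf right_diff_distrib)
  also have "\<dots> = (\<Sum>i\<in>S. f i)"
  proof (rule sum.mono_neutral_right)
    show "\<forall>i\<in>{1..M} - S. f i = 0"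
    proof
      fix i assume i: "i \<in> {1..M} - S"
      consider "i = j" | "C i + h \<le> C j" | "C j + h \<le> C i"
        using i by (fastforce simp: S_def active_set_def abs_if split: if_splits)
      thus "f i = 0"
      proof cases
        case 1
        thus ?thesis by (simp add: f_def \<tau>_def epan_cdf_def)
      next
        case 2
        hence "1 \<le> (C j - C i) / h" using h by (simp add: field_simps)
        \<comment> \<open>At distance exactly \<open>h\<close> the middle branch still applies and
          gives 1 here, and 0 in the mirrored case; this fits the strict inequality in
          \<open>active_set\<close>.\<close>
        hence "epan_cdf ((C j - C i) / h) = 1" by (cases "(C j - C i) / h = 1") (auto simp: epan_cdf_def)
        moreover have "\<tau> i = 1" using 2 h order[of i] i by (simp add: \<tau>_def)
        ultimately show ?thesis by (simp add: f_def)
      next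
        case 3
        hence "(C j - C i) / h \<le> -1" using h by (simp add: field_simps)
        hence "epan_cdf ((C j - C i) / h) = 0"
          by (cases "(C j - C i) / h = -1") (auto simp: epan_cdf_def)
        moreover have "\<tau> i = 0" using 3 h order[of i] i by (simp add: \<tau>_def)
        ultimately show ?thesis by (simp add: f_def)
      qed
    qed
  qed (auto simp: S_def active_set_def)
  also have "\<dots> = (\<Sum>i\<in>S. g i)"
  proof (rule sum.cong)
    fix i assume "i \<in> S"
    hence i: "i \<in> {1..M}" "i \<noteq> j" "\<bar>C i - C j\<bar> < h"
      by (auto simp: S_def active_set_def)
    \<comment> \<open>The CDF is evaluated at \<open>- x\<close>; besides the constant 1/2 it has
      only odd powers, whence the signs in front of \<open>coeff1\<close> and
      \<open>coeff3\<close>.\<close>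
    define x where "x = (C i - C j) * (1 / h)"
    have quot: "(C j - C i) / h = - x"
      by (simp add: x_def minus_divide_left)
    have "\<bar>x\<bar> < 1"
      using i h by (simp add: x_def abs_mult)
    hence "epan_cdf (- x) = 1/2 - 3/4 * x + 1/4 * x ^ 3"
      by (auto simp: epan_cdf_def abs_less_iff)
    \<comment> \<open>Subtracting the weight turns the constant 1/2 into half a sign, the source of
      \<open>coeff0\<close>.\<close>
    moreover have "1/2 - \<tau> i = 1/2 * sgn (C i - C j)"
      using i order[of i] by (auto simp: \<tau>_def sgn_if)
    ultimately have "epan_cdf (- x) - \<tau> i = 1/2 * sgn (C i - C j) - 3/4 * x + 1/4 * x ^ 3"
      by simp
    hence "f i = \<Delta> i * (1/2 * sgn (C i - C j) - 3/4 * x + 1/4 * x ^ 3)"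
      unfolding f_def quot by (simp only:)
    thus "f i = g i"
      unfolding g_def x_def power_mult_distrib by (simp only: algebra_simps)
  qed simp
  also have "\<dots> = coeff0 C \<Delta> j S - 3/4 * coeff1 C \<Delta> j S * (1 / h) + 1/4 * coeff3 C \<Delta> j S * (1 / h) ^ 3"
    unfolding g_def coeff0_def coeff1_def coeff3_def
    by (simp only: sum.distrib sum_subtractf sum_distrib_left sum_distrib_right)
  finally show ?thesis .
qed

text \<open>Up to the smallest gap between atoms every active set is empty, so all coefficients are
  empty sums.\<close>

lemma dev_eq_0_near_0:
  assumes mono: "strict_mono_on {1..M} C"
  obtains \<delta> where "0 < \<delta>" "\<And>j h. j \<in> {1..M} \<Longrightarrow> 0 < h \<Longrightarrow> h \<le> \<delta> \<Longrightarrow> dev C \<Delta> M j h = 0"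
proof
  \<comment> \<open>The element 1 keeps \<open>G\<close> nonempty when there are no two distinct
    atoms.\<close>
  define G where "G = insert 1 ((\<lambda>(i, j). \<bar>C i - C j\<bar>) ` {(i, j) \<in> {1..M} \<times> {1..M}. i \<noteq> j})"
  have fin: "finite G"
    unfolding G_def by (auto intro!: finite_imageI intro: finite_subset[of _ "{1..M} \<times> {1..M}"])
  show "0 < Min G"
    using fin strict_mono_on_eq[OF mono] by (subst Min_gr_iff) (auto simp: G_def)
  fix j h assume j: "j \<in> {1..M}" and h: "0 < h" "h \<le> Min G"
  have "h \<le> \<bar>C i - C j\<bar>" if "i \<in> {1..M}" "i \<noteq> j" for i
    using that j fin h(2) by (intro order.trans[OF h(2) Min_le]) (auto simp: G_def)
  hence "active_set C M j h = {}"
    by (fastforce simp: active_set_def)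
  thus "dev C \<Delta> M j h = 0"
    using dev_eq_cubic[OF mono j h(1), of \<Delta>] by (simp add: coeff0_def coeff1_def coeff3_def)
qed

section \<open>Crossings\<close>

lemma max_dev_iff:
  assumes "M \<ge> 1"
  shows "max_dev C \<Delta> M h \<le> \<epsilon> \<longleftrightarrow> (\<forall>j\<in>{1..M}. \<bar>dev C \<Delta> M j h\<bar> \<le> \<epsilon>)"
    and "max_dev C \<Delta> M h < \<epsilon> \<longleftrightarrow> (\<forall>j\<in>{1..M}. \<bar>dev C \<Delta> M j h\<bar> < \<epsilon>)"
  unfolding max_dev_def using assms by (auto simp: Max_less_iff)

text \<open>Every positive \<open>h\<close> lies in exactly one active interval, that of its own
  active set, and there the cubic is the deviation by \<open>dev_eq_cubic\<close>.\<close>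

lemma atom_crossings_eq:
  assumes "strict_mono_on {1..M} C" "j \<in> {1..M}" "0 < \<epsilon>"
  shows "atom_crossings C \<Delta> M \<epsilon> j = {h. 0 < h \<and> \<bar>dev C \<Delta> M j h\<bar> = \<epsilon>}"
proof -
  have "h \<in> atom_crossings C \<Delta> M \<epsilon> j \<longleftrightarrow> 0 < h \<and> dev C \<Delta> M j h \<in> {\<epsilon>, -\<epsilon>}" for h
    using dev_eq_cubic[OF assms(1,2), of h \<Delta>]
    by (auto simp: atom_crossings_def crossings_def active_interval_def active_sets_def)
  with assms(3) show ?thesis
    by (auto simp: abs_eq_iff')
qed

text \<open>Activity is a strict inequality on finitely many distances, so it survives a slight
  decrease of \<open>h\<close>; a decrease never activates new atoms.\<close>

lemma left_open_active_interval:
  assumes "0 < h"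
  obtains g where "0 < g" "g < h" "active_set C M j g = active_set C M j h"
proof -
  \<comment> \<open>The element 0 makes \<open>A\<close> nonempty and forces \<open>g\<close> to be
    positive.\<close>
  define A where "A = insert 0 ((\<lambda>i. \<bar>C i - C j\<bar>) ` active_set C M j h)"
  have fin: "finite A"
    by (simp add: A_def active_set_def)
  moreover from this have "Max A < h"
    using assms by (subst Max_less_iff) (auto simp: A_def active_set_def)
  ultimately obtain g where g: "Max A < g" "g < h"
    using dense by blast
  have "\<forall>a\<in>A. a < g"
    using g(1) fin by (subst (asm) Max_less_iff) (auto simp: A_def)
  hence "0 < g" "active_set C M j g = active_set C M j h"
    using g(2) by (auto simp: A_def active_set_def)
  with g(2) that show thesis
    by blast
qed

text \<open>Taking \<open>h\<close> to \<open>1 / h\<close> maps the crossings injectively into the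
  roots of a nonzero polynomial.\<close>

lemma finite_crossings:
  assumes "\<not> (coeff1 C \<Delta> j S = 0 \<and> coeff3 C \<Delta> j S = 0)"
  shows "finite (crossings C \<Delta> M j S e)"
proof -
  define P where "P = [:coeff0 C \<Delta> j S - e, - 3/4 * coeff1 C \<Delta> j S, 0, 1/4 * coeff3 C \<Delta> j S:]"
  have "P \<noteq> 0"
    using assms by (auto simp: P_def)
  hence "finite {u. poly P u = 0}"
    by (rule poly_roots_finite)
  moreover have "(\<lambda>h. 1 / h) ` crossings C \<Delta> M j S e \<subseteq> {u. poly P u = 0}"
    by (auto simp: crossings_def P_def algebra_simps power3_eq_cube)
  moreover have "inj_on (\<lambda>h. 1 / h) (crossings C \<Delta> M j S e)"
    by (auto simp: inj_on_def)
  ultimately show ?thesis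
    using finite_imageD finite_subset by blast
qed

lemma finite_proper_atom_crossings: "finite (proper_atom_crossings C \<Delta> M \<epsilon> j)"
proof -
  have "active_sets C M j \<subseteq> Pow {1..M}"
    by (auto simp: active_sets_def active_set_def)
  hence "finite (active_sets C M j)"
    by (rule finite_subset) simp
  thus ?thesis
    unfolding proper_atom_crossings_def by (auto intro: finite_crossings)
qed

lemma proper_atom_crossings_subset: "proper_atom_crossings C \<Delta> M \<epsilon> j \<subseteq> atom_crossings C \<Delta> M \<epsilon> j"
  by (auto simp: proper_atom_crossings_def atom_crossings_def)

text \<open>A first crossing survives the discarding of constant equations: such an equation holding
  at \<open>h\<close> would also hold at some \<open>g < h\<close> with the same active set.\<close>

lemma first_crossing_proper:
  assumes mono: "strict_mono_on {1..M} C" and j: "j \<in> {1..M}"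
    and h: "0 < h" "\<bar>dev C \<Delta> M j h\<bar> = \<epsilon>"
    and first: "\<And>g. 0 < g \<Longrightarrow> g < h \<Longrightarrow> \<bar>dev C \<Delta> M j g\<bar> \<noteq> \<epsilon>"
  shows "h \<in> proper_atom_crossings C \<Delta> M \<epsilon> j"
proof -
  define S where "S = active_set C M j h"
  have "\<not> (coeff1 C \<Delta> j S = 0 \<and> coeff3 C \<Delta> j S = 0)"
  proof
    assume const: "coeff1 C \<Delta> j S = 0 \<and> coeff3 C \<Delta> j S = 0"
    obtain g where g: "0 < g" "g < h" "active_set C M j g = S"
      using left_open_active_interval[OF h(1)] unfolding S_def by blast
    have "dev C \<Delta> M j g = dev C \<Delta> M j h"
      using const dev_eq_cubic[OF mono j g(1), of \<Delta>] dev_eq_cubic[OF mono j h(1), of \<Delta>] g(3)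
      by (simp flip: S_def)
    with first[OF g(1,2)] h(2) show False
      by simp
  qed
  moreover have "S \<in> active_sets C M j"
    using h(1) by (simp add: S_def active_sets_def)
  moreover have "h \<in> crossings C \<Delta> M j S (dev C \<Delta> M j h)"
    using h(1) dev_eq_cubic[OF mono j h(1), of \<Delta>]
    by (simp add: crossings_def active_interval_def S_def)
  moreover have "dev C \<Delta> M j h \<in> {\<epsilon>, -\<epsilon>}"
    using h(2) by auto
  ultimately show ?thesis
    unfolding proper_atom_crossings_def by blast
qed

text \<open>Dividing by a quarter of \<open>coeff3\<close> makes the equation monic in
  \<open>u\<close>; it has no quadratic term, so Cardano's formula applies without a shift.\<close>

lemma crossings_eq_cardano:
  assumes "coeff3 C \<Delta> j S \<noteq> 0"
  shows "crossings C \<Delta> M j S e = {h \<in> active_interval C M j S. \<exists>k<3. complex_of_real (1 / h) =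
    cardano_root (- 3 * coeff1 C \<Delta> j S / coeff3 C \<Delta> j S) (4 * (coeff0 C \<Delta> j S - e) / coeff3 C \<Delta> j S) k}"
proof -
  have iff: "coeff0 C \<Delta> j S - 3/4 * coeff1 C \<Delta> j S * u + 1/4 * coeff3 C \<Delta> j S * u ^ 3 = e \<longleftrightarrow>
      u ^ 3 + (- 3 * coeff1 C \<Delta> j S / coeff3 C \<Delta> j S) * u
        + 4 * (coeff0 C \<Delta> j S - e) / coeff3 C \<Delta> j S = 0" (is "?l = e \<longleftrightarrow> ?r = 0") for u
  proof -
    have "?l - e = coeff3 C \<Delta> j S / 4 * ?r"
      using assms by (simp add: distrib_left diff_divide_distrib right_diff_distrib)
    hence "?l - e = 0 \<longleftrightarrow> ?r = 0"
      using assms by (simp only: mult_eq_0_iff) simp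
    thus ?thesis
      by (simp only: right_minus_eq)
  qed
  show ?thesis
    unfolding crossings_def cardano_root_real_iff[symmetric] by (simp only: iff simp_thms)
qed

lemma crossings_eq_linear:
  assumes "coeff3 C \<Delta> j S = 0" "coeff1 C \<Delta> j S \<noteq> 0"
  shows "crossings C \<Delta> M j S e =
    {h \<in> active_interval C M j S. 1 / h = 4 * (coeff0 C \<Delta> j S - e) / (3 * coeff1 C \<Delta> j S)}"
proof -
  have "coeff0 C \<Delta> j S - 3/4 * coeff1 C \<Delta> j S * u = e \<longleftrightarrow>
      u = 4 * (coeff0 C \<Delta> j S - e) / (3 * coeff1 C \<Delta> j S)" for u
    using assms(2) by (auto simp: field_simps)
  with assms(1) show ?thesis
    by (simp add: crossings_def)
qed

lemma crossings_closed_form: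
  "let c0 = coeff0 C \<Delta> j S; c1 = coeff1 C \<Delta> j S; c3 = coeff3 C \<Delta> j S in
    (c3 \<noteq> 0 \<longrightarrow> crossings C \<Delta> M j S e =
       {h \<in> active_interval C M j S.
          \<exists>k<3. complex_of_real (1 / h) = cardano_root (- 3 * c1 / c3) (4 * (c0 - e) / c3) k}) \<and>
    (c3 = 0 \<and> c1 \<noteq> 0 \<longrightarrow> crossings C \<Delta> M j S e =
       {h \<in> active_interval C M j S. 1 / h = 4 * (c0 - e) / (3 * c1)})"
  unfolding Let_def by (intro conjI impI crossings_eq_cardano crossings_eq_linear) simp_all

section \<open>The largest feasible bandwidth\<close>

text \<open>If all of the finitely many deviations were below \<epsilon> at \<open>hstar\<close>,
  continuity would keep them below it slightly to the right, against maximality.\<close>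

lemma max_feasible_attains:
  assumes M: "M \<ge> 1"
    and hstar: "hstar \<in> feasible C \<Delta> M \<epsilon>" "\<And>h. h \<in> feasible C \<Delta> M \<epsilon> \<Longrightarrow> h \<le> hstar"
  shows "\<exists>j\<in>{1..M}. \<bar>dev C \<Delta> M j hstar\<bar> = \<epsilon>"
proof (rule ccontr)
  assume "\<not> ?thesis"
  with hstar(1) have less: "\<forall>j\<in>{1..M}. \<bar>dev C \<Delta> M j hstar\<bar> < \<epsilon>" and pos: "0 < hstar"
    by (force simp: feasible_def max_dev_iff[OF M])+
  have "\<forall>j\<in>{1..M}. eventually (\<lambda>h. \<bar>dev C \<Delta> M j h\<bar> < \<epsilon>) (at hstar)"
  proof
    fix j assume "j \<in> {1..M}"
    have "isCont (dev C \<Delta> M j) hstar"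
      using continuous_on_dev pos by (simp add: continuous_on_eq_continuous_at)
    hence "((\<lambda>h. \<bar>dev C \<Delta> M j h\<bar>) \<longlongrightarrow> \<bar>dev C \<Delta> M j hstar\<bar>) (at hstar)"
      unfolding isCont_def by (rule tendsto_rabs)
    thus "eventually (\<lambda>h. \<bar>dev C \<Delta> M j h\<bar> < \<epsilon>) (at hstar)"
      using less \<open>j \<in> {1..M}\<close> by (auto intro: order_tendstoD)
  qed
  hence "eventually (\<lambda>h. \<forall>j\<in>{1..M}. \<bar>dev C \<Delta> M j h\<bar> < \<epsilon>) (at hstar)"
    by (intro eventually_ball_finite) auto
  hence "eventually (\<lambda>h. \<forall>j\<in>{1..M}. \<bar>dev C \<Delta> M j h\<bar> < \<epsilon>) (at_right hstar)"
    by (rule filter_leD[rotated]) (simp add: at_le)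
  then obtain b where b: "hstar < b" "\<forall>h. hstar < h \<longrightarrow> h < b \<longrightarrow> (\<forall>j\<in>{1..M}. \<bar>dev C \<Delta> M j h\<bar> < \<epsilon>)"
    unfolding eventually_at_right_field by blast
  obtain h where h: "hstar < h" "h < b"
    using dense b(1) by blast
  hence "h \<in> feasible C \<Delta> M \<epsilon>"
    using b(2) pos by (force simp: feasible_def max_dev_iff[OF M])
  with hstar(2) h(1) show False
    by force
qed

text \<open>The first hit is the least element of the set of all hits up to \<open>b\<close>, which
  is compact because it stays away from 0.\<close>

lemma first_hit_exists:
  assumes M: "M \<ge> 1" and mono: "strict_mono_on {1..M} C" and \<epsilon>: "0 < \<epsilon>"
    and b: "0 < b" "{0<..b} \<subseteq> feasible C \<Delta> M \<epsilon>" "\<exists>j\<in>{1..M}. \<bar>dev C \<Delta> M j b\<bar> = \<epsilon>"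
  obtains h where "first_hit C \<Delta> M \<epsilon> h"
proof -
  obtain \<delta> where \<delta>: "0 < \<delta>" "\<And>j h. j \<in> {1..M} \<Longrightarrow> 0 < h \<Longrightarrow> h \<le> \<delta> \<Longrightarrow> dev C \<Delta> M j h = 0"
    using dev_eq_0_near_0[OF mono] by blast
  \<comment> \<open>Starting at \<delta> loses no hit, since the deviations vanish up to there and
    \<epsilon> is positive.\<close>
  define A where "A = (\<Union>j\<in>{1..M}. {h \<in> {\<delta>..b}. \<bar>dev C \<Delta> M j h\<bar> = \<epsilon>})"
  have A: "h \<in> A" if "0 < h" "h \<le> b" "j \<in> {1..M}" "\<bar>dev C \<Delta> M j h\<bar> = \<epsilon>" for h j
    using that \<delta>(2)[of j h] \<epsilon> unfolding A_def by (cases "h \<le> \<delta>") auto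
  have "compact A"
    unfolding A_def
  proof (intro compact_UN finite_atLeastAtMost ballI)
    fix j
    have "continuous_on {\<delta>..b} (dev C \<Delta> M j)"
      by (rule continuous_on_subset[OF continuous_on_dev]) (use \<delta>(1) in auto)
    hence "closedin (top_of_set {\<delta>..b}) {h \<in> {\<delta>..b}. \<bar>dev C \<Delta> M j h\<bar> = \<epsilon>}"
      by (intro continuous_closedin_preimage_constant continuous_intros)
    thus "compact {h \<in> {\<delta>..b}. \<bar>dev C \<Delta> M j h\<bar> = \<epsilon>}"
      by (rule closedin_compact[OF compact_Icc])
  qed
  moreover have "A \<noteq> {}"
    using A b(1,3) by blast
  ultimately obtain h where h: "h \<in> A" "\<forall>g\<in>A. h \<le> g"
    using compact_attains_inf[of A] by blast
  have pos: "0 < h" and hb: "h \<le> b" and hit: "\<exists>j\<in>{1..M}. \<bar>dev C \<Delta> M j h\<bar> = \<epsilon>"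
    using h(1) \<delta>(1) by (auto simp: A_def)
  have le: "\<forall>j\<in>{1..M}. \<bar>dev C \<Delta> M j g\<bar> \<le> \<epsilon>" if "0 < g" "g \<le> b" for g
    using b(2) that by (auto simp: feasible_def max_dev_iff[OF M])
  have "max_dev C \<Delta> M h \<le> \<epsilon>" "\<not> max_dev C \<Delta> M h < \<epsilon>"
    using le[OF pos hb] hit by (auto simp: max_dev_iff[OF M])
  \<comment> \<open>Feasibility up to \<open>b\<close> bounds the deviations by \<epsilon>, and
    minimality of \<open>h\<close> excludes equality before it.\<close>
  moreover have "max_dev C \<Delta> M g < \<epsilon>" if g: "0 < g" "g < h" for g
  proof -
    have "\<bar>dev C \<Delta> M j g\<bar> \<noteq> \<epsilon>" if "j \<in> {1..M}" for j
      using A[of g j] h(2) g hb that by fastforce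
    thus ?thesis
      unfolding max_dev_iff(2)[OF M] using le[of g] g hb by (auto simp: order.order_iff_strict)
  qed
  ultimately have "first_hit C \<Delta> M \<epsilon> h"
    using pos by (auto simp: first_hit_def)
  thus thesis
    by (rule that)
qed

theorem theorem7:
  fixes C \<Delta> :: "nat \<Rightarrow> real" and M :: nat and \<epsilon> hstar :: real
  assumes "M \<ge> 1"
    and "strict_mono_on {1..M} C"
    and "\<And>i. i \<in> {1..M} \<Longrightarrow> 0 \<le> \<Delta> i"
    and "0 < \<epsilon>"
    and "hstar \<in> feasible C \<Delta> M \<epsilon>" and "\<And>h. h \<in> feasible C \<Delta> M \<epsilon> \<Longrightarrow> h \<le> hstar"
    and "connected (feasible C \<Delta> M \<epsilon>)"
    and "\<And>h. first_hit C \<Delta> M \<epsilon> h \<Longrightarrow> h = hstar"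
  shows "feasible C \<Delta> M \<epsilon> = {0<..hstar} \<and>
     initial_feasible C \<Delta> M \<epsilon> = {0<..hstar} \<and>
     (\<exists>j\<in>{1..M}. \<bar>dev C \<Delta> M j hstar\<bar> = \<epsilon>) \<and>
     (\<forall>h. 0 < h \<and> h < hstar \<longrightarrow> (\<forall>j\<in>{1..M}. \<bar>dev C \<Delta> M j h\<bar> \<noteq> \<epsilon>)) \<and>
     ereal hstar = (MIN j\<in>{1..M}. INF h\<in>{h. 0 < h \<and> \<bar>dev C \<Delta> M j h\<bar> = \<epsilon>}. ereal h) \<and>
     (\<forall>j\<in>{1..M}. {h. 0 < h \<and> \<bar>dev C \<Delta> M j h\<bar> = \<epsilon>} = atom_crossings C \<Delta> M \<epsilon> j) \<and>
     hstar \<in> (\<Union>j\<in>{1..M}. atom_crossings C \<Delta> M \<epsilon> j) \<and>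
     (\<forall>h\<in>(\<Union>j\<in>{1..M}. atom_crossings C \<Delta> M \<epsilon> j). hstar \<le> h) \<and>
     finite (\<Union>j\<in>{1..M}. proper_atom_crossings C \<Delta> M \<epsilon> j) \<and>
     (\<Union>j\<in>{1..M}. proper_atom_crossings C \<Delta> M \<epsilon> j) \<noteq> {} \<and>
     hstar = Min (\<Union>j\<in>{1..M}. proper_atom_crossings C \<Delta> M \<epsilon> j) \<and>
     (\<forall>j\<in>{1..M}. \<forall>S\<in>active_sets C M j. \<forall>e\<in>{\<epsilon>, -\<epsilon>}.
        let c0 = coeff0 C \<Delta> j S; c1 = coeff1 C \<Delta> j S; c3 = coeff3 C \<Delta> j S in
          (c3 \<noteq> 0 \<longrightarrow> crossings C \<Delta> M j S e =
             {h \<in> active_interval C M j S.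
                \<exists>k<3. complex_of_real (1 / h) = cardano_root (- 3 * c1 / c3) (4 * (c0 - e) / c3) k}) \<and>
          (c3 = 0 \<and> c1 \<noteq> 0 \<longrightarrow> crossings C \<Delta> M j S e =
             {h \<in> active_interval C M j S. 1 / h = 4 * (c0 - e) / (3 * c1)}))"
proof -
  note M = assms(1) and mono = assms(2) and \<epsilon> = assms(4)
  have pos: "0 < hstar"
    using assms(5) by (simp add: feasible_def)
  obtain \<delta> where \<delta>: "0 < \<delta>" "\<And>j h. j \<in> {1..M} \<Longrightarrow> 0 < h \<Longrightarrow> h \<le> \<delta> \<Longrightarrow> dev C \<Delta> M j h = 0"
    using dev_eq_0_near_0[OF mono] by blast
  have small: "h \<in> feasible C \<Delta> M \<epsilon>" if "0 < h" "h \<le> \<delta>" for h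
    using that \<delta>(2) \<epsilon> by (simp add: feasible_def max_dev_iff[OF M])
  have feas: "feasible C \<Delta> M \<epsilon> = {0<..hstar}"
  proof (rule antisym)
    show "feasible C \<Delta> M \<epsilon> \<subseteq> {0<..hstar}"
    proof
      fix h assume h: "h \<in> feasible C \<Delta> M \<epsilon>"
      thus "h \<in> {0<..hstar}"
        using assms(6)[OF h] by (simp add: feasible_def)
    qed
    show "{0<..hstar} \<subseteq> feasible C \<Delta> M \<epsilon>"
    proof
      fix h assume h: "h \<in> {0<..hstar}"
      \<comment> \<open>This gives a feasible point at or to the left of \<open>h\<close>;
        connectedness then fills the gap up to \<open>hstar\<close>.\<close>
      have "min h \<delta> \<in> feasible C \<Delta> M \<epsilon>"
        using h \<delta>(1) by (intro small) auto
      hence "{min h \<delta>..hstar} \<subseteq> feasible C \<Delta> M \<epsilon>"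
        using assms(5,7) by (intro connected_contains_Icc)
      thus "h \<in> feasible C \<Delta> M \<epsilon>"
        using h by auto
    qed
  qed
  have initial: "initial_feasible C \<Delta> M \<epsilon> = {0<..hstar}"
    unfolding initial_feasible_def feas by (rule set_eqI) (auto simp: Ioc_subset_iff)
  have ex: "\<exists>j\<in>{1..M}. \<bar>dev C \<Delta> M j hstar\<bar> = \<epsilon>"
    using max_feasible_attains[OF M assms(5,6)] .
  \<comment> \<open>A first hit exists because \<epsilon> is attained at \<open>hstar\<close>; the
    hypothesis on first hits then identifies it with \<open>hstar\<close>.\<close>
  obtain h where h: "first_hit C \<Delta> M \<epsilon> h"
    by (rule first_hit_exists[OF M mono \<epsilon> pos _ ex]) (simp add: feas)
  have "first_hit C \<Delta> M \<epsilon> hstar"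
    using h assms(8)[OF h] by simp
  hence before: "\<bar>dev C \<Delta> M j h\<bar> \<noteq> \<epsilon>" if "0 < h" "h < hstar" "j \<in> {1..M}" for j h
    using that by (force simp: first_hit_def max_dev_iff[OF M])
  define A where "A j = {h. 0 < h \<and> \<bar>dev C \<Delta> M j h\<bar> = \<epsilon>}" for j
  define P where "P = (\<Union>j\<in>{1..M}. proper_atom_crossings C \<Delta> M \<epsilon> j)"
  have atom: "atom_crossings C \<Delta> M \<epsilon> j = A j" if "j \<in> {1..M}" for j
    using atom_crossings_eq[OF mono that \<epsilon>] by (simp add: A_def)
  obtain j0 where j0: "j0 \<in> {1..M}" "hstar \<in> A j0"
    using ex pos by (auto simp: A_def)
  have lower: "hstar \<le> h" if "h \<in> A j" "j \<in> {1..M}" for h j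
    using before[of h j] that by (force simp: A_def)
  \<comment> \<open>In the extended reals the infimum over an empty \<open>A j\<close> is infinite,
    so atoms that never reach \<epsilon> do not affect the minimum; \<open>j0\<close> attains
    it.\<close>
  have inf: "ereal hstar = (MIN j\<in>{1..M}. INF h\<in>A j. ereal h)"
  proof (rule Min_eqI[symmetric])
    fix y assume "y \<in> (\<lambda>j. INF h\<in>A j. ereal h) ` {1..M}"
    thus "ereal hstar \<le> y"
      using lower by (auto intro!: INF_greatest)
  next
    have "(INF h\<in>A j0. ereal h) = ereal hstar"
      using j0 lower by (intro antisym INF_lower INF_greatest) auto
    thus "ereal hstar \<in> (\<lambda>j. INF h\<in>A j. ereal h) ` {1..M}"
      using j0(1) by (metis imageI)
  qed simp
  \<comment> \<open>No atom reaches \<epsilon> before \<open>hstar\<close>, so this is the first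
    crossing of \<open>j0\<close>.\<close>
  have in_P: "hstar \<in> P"
    using first_crossing_proper[OF mono j0(1) pos, of \<Delta> \<epsilon>] j0 before by (auto simp: P_def A_def)
  have fin: "finite P"
    by (simp add: P_def finite_proper_atom_crossings)
  have min: "hstar = Min P"
  proof (rule Min_eqI[symmetric])
    fix h assume "h \<in> P"
    thus "hstar \<le> h"
      using proper_atom_crossings_subset atom lower unfolding P_def by blast
  qed (use in_P fin in auto)
  have before': "\<forall>h. 0 < h \<and> h < hstar \<longrightarrow> (\<forall>j\<in>{1..M}. \<bar>dev C \<Delta> M j h\<bar> \<noteq> \<epsilon>)"
    using before by blast
  have in_A: "hstar \<in> \<Union> (A ` {1..M})" and lower': "\<forall>h\<in>\<Union> (A ` {1..M}). hstar \<le> h"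
    using lower j0 by blast+
  have ne: "P \<noteq> {}"
    using in_P by blast
  have atoms: "(\<Union>j\<in>{1..M}. atom_crossings C \<Delta> M \<epsilon> j) = \<Union> (A ` {1..M})"
    using atom by (rule SUP_cong[OF refl])
  show ?thesis
    unfolding P_def[symmetric] A_def[symmetric] atoms
    by (intro conjI feas initial ex before' inf in_A lower' fin ne min
        ballI atom[symmetric] crossings_closed_form)
qed

end
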